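(* The powerset of the natural numbers under inclusion, $(\mathcal{P}(\omega),\subseteq)$, embeds (as a partial order) into $\mathsf{TLH}$. In particular, $\mathsf{TLH}$ has antichains and chains of size $2^{\aleph_0}$, and both its width and its height are exactly $2^{\aleph_0}$.
   Context: Fix a standard (acceptable) enumeration $(\varphi_e)_{e\in\omega}$ of the partial computable functions and let $W_e=\operatorname{dom}(\varphi_e)$. Write $e=^{\mathrm{ce}}e'$ iff $W_e=W_{e'}$. Let $\mathcal{R}^{\mathrm{ce}}$ be the set of all equivalence relations on $\omega$ extending $=^{\mathrm{ce}}$ (no definability or effectivity is assumed). An enumeration of a set $A$ is a surjection $\mu:\omega\to A$; $\mu[s]$ denotes the finite string $\mu(0),\dots,\mu(s-1)$. A learner is an arbitrary function $\mathbf{M}:\omega^{<\omega}\to\omega$ (no effectivity is assumed). For $E^{\mathrm{ce}}\in\mathcal{R}^{\mathrm{ce}}$, a family $\mathfrak{K}$ of nonempty c.e. sets is $E^{\mathrm{ce}}$-learnable if there is a learner $\mathbf{M}$ such that for every $e$ with $W_e\in\mathfrak{K}$ and every enumeration $\mu$ of $W_e$ there is $i\in\omega$ with $i\mathrel{E^{\mathrm{ce}}}e$ and $\mathbf{M}(\mu[s])=i$ for all sufficiently large $s$. $E^{\mathrm{ce}}\leq_{\mathrm{Learn}}F^{\mathrm{ce}}$ means that every $E^{\mathrm{ce}}$-learnable family of nonempty c.e. sets is also $F^{\mathrm{ce}}$-learnable; $E^{\mathrm{ce}}\equiv_{\mathrm{Learn}}F^{\mathrm{ce}}$ means both $E^{\mathrm{ce}}\leq_{\mathrm{Learn}}F^{\mathrm{ce}}$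 and $F^{\mathrm{ce}}\leq_{\mathrm{Learn}}E^{\mathrm{ce}}$. The tolerant learning hierarchy $\mathsf{TLH}$ is the poset $(\mathcal{E}^{\mathrm{ce}},\leq)$ where $\mathcal{E}^{\mathrm{ce}}=\mathcal{R}^{\mathrm{ce}}/{\equiv_{\mathrm{Learn}}}$ and $\leq$ is induced by $\leq_{\mathrm{Learn}}$. In a poset, a chain is a set of pairwise comparable elements and an antichain is a set of pairwise incomparable (distinct) elements. The height (respectively width) of a poset is the supremum of the cardinalities of its chains (respectively antichains). *)

theory Defs
  imports Main
begin

unbundle cardinal_syntax

section \<open>Partial computable functions and acceptable enumerations\<close>

text \<open>
  Codes do not carry an arity: a code denotes, for every \<open>k\<close>, a partial function of \<open>k\<close> arguments.
  The \<open>k\<close>-ary partial functions so obtained are exactly the \<open>k\<close>-ary partial recursive functions;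
  applying a code to a list of unsuitable length (for example \<open>Proj i\<close> to a list of
  length at most \<open>i\<close>) gives the nowhere defined function.
\<close>

datatype recf =
    Zero
  | Succ
  | Proj nat
  | Comp recf "recf list"
  | PrimRec recf recf
  | Mu recf

text \<open>\<open>eval c xs y\<close>: the computation of \<open>c\<close> on the arguments \<open>xs\<close> halts with value \<open>y\<close>.\<close>

inductive eval :: "recf \<Rightarrow> nat list \<Rightarrow> nat \<Rightarrow> bool" where
  eval_Zero: "eval Zero xs 0"
| eval_Succ: "eval Succ [x] (Suc x)"
| eval_Proj: "i < length xs \<Longrightarrow> eval (Proj i) xs (xs ! i)"
| eval_Comp: "list_all2 (\<lambda>g y. eval g xs y) gs ys \<Longrightarrow> eval f ys z \<Longrightarrow> eval (Comp f gs) xs z"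
| eval_PrimRec_0: "eval f xs y \<Longrightarrow> eval (PrimRec f g) (0 # xs) y"
| eval_PrimRec_Suc:
    "eval (PrimRec f g) (n # xs) y \<Longrightarrow> eval g (n # y # xs) z \<Longrightarrow> eval (PrimRec f g) (Suc n # xs) z"
| eval_Mu: "eval f (n # xs) 0 \<Longrightarrow> (\<forall>m<n. \<exists>y>0. eval f (m # xs) y) \<Longrightarrow> eval (Mu f) xs n"

lemma eval_deterministic: "eval c xs y \<Longrightarrow> eval c xs z \<Longrightarrow> y = z"
proof (induction c xs y arbitrary: z rule: eval.induct)
  case (eval_Comp xs gs ys f z z')
  from eval_Comp.prems obtain ys' where
    ys': "list_all2 (\<lambda>g y. eval g xs y) gs ys'" "eval f ys' z'"
    by (auto elim: eval.cases)
  have "ys = ys'"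
    using eval_Comp.IH(1) ys'(1) by (auto simp: list_all2_conv_all_nth intro!: nth_equalityI)
  with ys'(2) eval_Comp.IH(2) show ?case by blast
next
  case (eval_PrimRec_0 f xs y g)
  from eval_PrimRec_0.prems show ?case
    by (cases rule: eval.cases) (auto dest: eval_PrimRec_0.IH)
next
  case (eval_PrimRec_Suc f g n xs y z z')
  from eval_PrimRec_Suc.prems obtain y' where "eval (PrimRec f g) (n # xs) y'" "eval g (n # y' # xs) z'"
    by (cases rule: eval.cases) auto
  with eval_PrimRec_Suc.IH show ?case by blast
next
  case (eval_Mu f n xs z)
  from eval_Mu.prems have z: "eval f (z # xs) 0" "\<forall>m<z. \<exists>y>0. eval f (m # xs) y"
    by (auto elim: eval.cases)
  show ?case
  proof (rule linorder_cases[of n z])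
    assume "n < z"
    with z(2) eval_Mu.IH(1) show ?thesis by fastforce
  next
    assume "z < n"
    with z(1) eval_Mu.IH(2) show ?thesis by fastforce
  qed
qed (auto elim: eval.cases)

definition partial_computable :: "(nat \<rightharpoonup> nat) \<Rightarrow> bool" where
  "partial_computable \<psi> \<longleftrightarrow> (\<exists>c. \<forall>x y. \<psi> x = Some y \<longleftrightarrow> eval c [x] y)"

definition partial_computable2 :: "(nat \<Rightarrow> nat \<rightharpoonup> nat) \<Rightarrow> bool" where
  "partial_computable2 \<psi> \<longleftrightarrow> (\<exists>c. \<forall>x y z. \<psi> x y = Some z \<longleftrightarrow> eval c [x, y] z)"

definition computable :: "(nat \<Rightarrow> nat) \<Rightarrow> bool" where
  "computable f \<longleftrightarrow> partial_computable (\<lambda>x. Some (f x))"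

text \<open>
  An acceptable enumeration lists the unary partial computable functions, has a partial computable
  universal function, and satisfies the parameter (s-m-n) theorem.
\<close>

definition acceptable :: "(nat \<Rightarrow> nat \<rightharpoonup> nat) \<Rightarrow> bool" where
  "acceptable \<phi> \<longleftrightarrow>
     range \<phi> = {\<psi>. partial_computable \<psi>} \<and>
     partial_computable2 \<phi> \<and>
     (\<forall>\<psi>. partial_computable2 \<psi> \<longrightarrow> (\<exists>f. computable f \<and> (\<forall>e. \<phi> (f e) = \<psi> e)))"

definition W :: "(nat \<Rightarrow> nat \<rightharpoonup> nat) \<Rightarrow> nat \<Rightarrow> nat set" where
  "W \<phi> e = dom (\<phi> e)"

definition eq_ce :: "(nat \<Rightarrow> nat \<rightharpoonup> nat) \<Rightarrow> nat rel" where
  "eq_ce \<phi> = {(e, e'). W \<phi> e = W \<phi> e'}"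

definition R_ce :: "(nat \<Rightarrow> nat \<rightharpoonup> nat) \<Rightarrow> nat rel set" where
  "R_ce \<phi> = {E. equiv UNIV E \<and> eq_ce \<phi> \<subseteq> E}"


section \<open>Learnability\<close>

definition enumeration_of :: "(nat \<Rightarrow> nat) \<Rightarrow> nat set \<Rightarrow> bool" where
  "enumeration_of \<mu> A \<longleftrightarrow> range \<mu> = A"

definition initial_string :: "(nat \<Rightarrow> nat) \<Rightarrow> nat \<Rightarrow> nat list" where
  "initial_string \<mu> s = map \<mu> [0..<s]"

definition ce_family :: "(nat \<Rightarrow> nat \<rightharpoonup> nat) \<Rightarrow> nat set set \<Rightarrow> bool" where
  "ce_family \<phi> K \<longleftrightarrow> (\<forall>A\<in>K. A \<noteq> {} \<and> A \<in> range (W \<phi>))"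

definition learnable :: "(nat \<Rightarrow> nat \<rightharpoonup> nat) \<Rightarrow> nat rel \<Rightarrow> nat set set \<Rightarrow> bool" where
  "learnable \<phi> E K \<longleftrightarrow>
     (\<exists>M :: nat list \<Rightarrow> nat. \<forall>e. W \<phi> e \<in> K \<longrightarrow>
        (\<forall>\<mu>. enumeration_of \<mu> (W \<phi> e) \<longrightarrow>
           (\<exists>i. (i, e) \<in> E \<and> (\<exists>s\<^sub>0. \<forall>s\<ge>s\<^sub>0. M (initial_string \<mu> s) = i))))"

definition learn_le :: "(nat \<Rightarrow> nat \<rightharpoonup> nat) \<Rightarrow> nat rel \<Rightarrow> nat rel \<Rightarrow> bool" where
  "learn_le \<phi> E F \<longleftrightarrow> (\<forall>K. ce_family \<phi> K \<longrightarrow> learnable \<phi> E K \<longrightarrow> learnable \<phi> F K)"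

definition learn_equiv :: "(nat \<Rightarrow> nat \<rightharpoonup> nat) \<Rightarrow> nat rel rel" where
  "learn_equiv \<phi> = {(E, F). E \<in> R_ce \<phi> \<and> F \<in> R_ce \<phi> \<and> learn_le \<phi> E F \<and> learn_le \<phi> F E}"

definition E_ce :: "(nat \<Rightarrow> nat \<rightharpoonup> nat) \<Rightarrow> nat rel set set" where
  "E_ce \<phi> = R_ce \<phi> // learn_equiv \<phi>"

text \<open>
  The tolerant learning hierarchy, given as its order relation; the underlying set is the field of
  this relation.
\<close>

definition TLH :: "(nat \<Rightarrow> nat \<rightharpoonup> nat) \<Rightarrow> nat rel set rel" where
  "TLH \<phi> = {(X, Y). X \<in> E_ce \<phi> \<and> Y \<in> E_ce \<phi> \<and> (\<exists>E\<in>X. \<exists>F\<in>Y. learn_le \<phi> E F)}"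

lemma learn_le_refl: "learn_le \<phi> E E"
  by (simp add: learn_le_def)

lemma learn_le_trans: "learn_le \<phi> E F \<Longrightarrow> learn_le \<phi> F G \<Longrightarrow> learn_le \<phi> E G"
  by (simp add: learn_le_def)

lemma equiv_learn_equiv: "equiv (R_ce \<phi>) (learn_equiv \<phi>)"
  by (rule equivI)
    (auto simp: learn_equiv_def refl_on_def sym_def trans_def intro: learn_le_refl learn_le_trans)

lemma TLH_class_iff:
  assumes "E \<in> R_ce \<phi>" "F \<in> R_ce \<phi>"
  shows "(learn_equiv \<phi> `` {E}, learn_equiv \<phi> `` {F}) \<in> TLH \<phi> \<longleftrightarrow> learn_le \<phi> E F"
proof
  assume "(learn_equiv \<phi> `` {E}, learn_equiv \<phi> `` {F}) \<in> TLH \<phi>"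
  then show "learn_le \<phi> E F"
    by (auto simp: TLH_def learn_equiv_def intro: learn_le_trans)
next
  assume "learn_le \<phi> E F"
  moreover have "E \<in> learn_equiv \<phi> `` {E}" "F \<in> learn_equiv \<phi> `` {F}"
    using assms by (auto simp: learn_equiv_def learn_le_refl)
  ultimately show "(learn_equiv \<phi> `` {E}, learn_equiv \<phi> `` {F}) \<in> TLH \<phi>"
    using assms by (auto simp: TLH_def E_ce_def intro: quotientI)
qed

lemma Field_TLH: "Field (TLH \<phi>) = E_ce \<phi>"
proof
  show "Field (TLH \<phi>) \<subseteq> E_ce \<phi>"
    by (auto simp: Field_def TLH_def)
  show "E_ce \<phi> \<subseteq> Field (TLH \<phi>)"
  proof
    fix X assume "X \<in> E_ce \<phi>"
    then obtain E where "E \<in> R_ce \<phi>" "X = learn_equiv \<phi> `` {E}"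
      by (auto simp: E_ce_def elim: quotientE)
    then have "(X, X) \<in> TLH \<phi>" by (simp add: TLH_class_iff learn_le_refl)
    then show "X \<in> Field (TLH \<phi>)" by (auto simp: Field_def)
  qed
qed

lemma Partial_order_TLH: "Partial_order (TLH \<phi>)"
proof -
  have ex: "\<exists>E. E \<in> R_ce \<phi> \<and> X = learn_equiv \<phi> `` {E}" if "X \<in> E_ce \<phi>" for X
    using that by (auto simp: E_ce_def elim: quotientE)
  have dom: "X \<in> E_ce \<phi> \<and> Y \<in> E_ce \<phi>" if "(X, Y) \<in> TLH \<phi>" for X Y
    using that by (simp add: TLH_def)
  have "TLH \<phi> \<subseteq> E_ce \<phi> \<times> E_ce \<phi>" using dom by auto
  moreover have "refl_on (E_ce \<phi>) (TLH \<phi>)"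
    using ex by (fastforce simp: refl_on_def TLH_class_iff learn_le_refl)
  moreover have "trans (TLH \<phi>)"
  proof (rule transI)
    fix X Y Z assume *: "(X, Y) \<in> TLH \<phi>" "(Y, Z) \<in> TLH \<phi>"
    obtain E F G where "E \<in> R_ce \<phi>" "X = learn_equiv \<phi> `` {E}"
      "F \<in> R_ce \<phi>" "Y = learn_equiv \<phi> `` {F}" "G \<in> R_ce \<phi>" "Z = learn_equiv \<phi> `` {G}"
      using * dom ex by metis
    with * show "(X, Z) \<in> TLH \<phi>" by (auto simp: TLH_class_iff intro: learn_le_trans)
  qed
  moreover have "antisym (TLH \<phi>)"
  proof (rule antisymI)
    fix X Y assume *: "(X, Y) \<in> TLH \<phi>" "(Y, X) \<in> TLH \<phi>"
    obtain E F where EF: "E \<in> R_ce \<phi>" "X = learn_equiv \<phi> `` {E}"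
      "F \<in> R_ce \<phi>" "Y = learn_equiv \<phi> `` {F}"
      using * dom ex by metis
    with * have "learn_le \<phi> E F" "learn_le \<phi> F E" by (simp_all add: TLH_class_iff)
    with EF have "(E, F) \<in> learn_equiv \<phi>" by (simp add: learn_equiv_def)
    with EF show "X = Y" using equiv_class_eq[OF equiv_learn_equiv] by blast
  qed
  ultimately show ?thesis
    by (simp add: partial_order_on_def preorder_on_def Field_TLH)
qed


section \<open>Embeddings, width and height of partial orders\<close>

definition order_embedding :: "'a rel \<Rightarrow> 'b rel \<Rightarrow> ('a \<Rightarrow> 'b) \<Rightarrow> bool" where
  "order_embedding r s h \<longleftrightarrow>
     h ` Field r \<subseteq> Field s \<and> inj_on h (Field r) \<and>
     (\<forall>x\<in>Field r. \<forall>y\<in>Field r. (x, y) \<in> r \<longleftrightarrow> (h x, h y) \<in> s)"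

text \<open>Chains are the library notion \<^const>\<open>Chains\<close>; its members are subsets of the field.\<close>

definition Antichains :: "'a rel \<Rightarrow> 'a set set" where
  "Antichains r = {C. C \<subseteq> Field r \<and> (\<forall>a\<in>C. \<forall>b\<in>C. a \<noteq> b \<longrightarrow> (a, b) \<notin> r \<and> (b, a) \<notin> r)}"

text \<open>
  \<open>\<kappa>\<close> is the least cardinal that bounds the cardinality of every member of \<open>\<C>\<close>.  Competing
  bounds \<open>\<nu>\<close> need only range over cardinals on the type underlying \<open>\<kappa>\<close>: every cardinal
  below \<open>\<kappa>\<close>, on whatever type, is equinumerous to one on that type.
\<close>

definition is_card_Sup :: "'a set set \<Rightarrow> 'b rel \<Rightarrow> bool" where
  "is_card_Sup \<C> \<kappa> \<longleftrightarrow>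
     Card_order \<kappa> \<and> (\<forall>C\<in>\<C>. |C| \<le>o \<kappa>) \<and>
     (\<forall>\<nu> :: 'b rel. Card_order \<nu> \<longrightarrow> (\<forall>C\<in>\<C>. |C| \<le>o \<nu>) \<longrightarrow> \<kappa> \<le>o \<nu>)"

definition has_height :: "'a rel \<Rightarrow> 'b rel \<Rightarrow> bool" where
  "has_height r \<kappa> \<longleftrightarrow> is_card_Sup (Chains r) \<kappa>"

definition has_width :: "'a rel \<Rightarrow> 'b rel \<Rightarrow> bool" where
  "has_width r \<kappa> \<longleftrightarrow> is_card_Sup (Antichains r) \<kappa>"

end

theory Submission
  imports Defs "HOL-Library.Nat_Bijection" "HOL-Library.Countable_Set"
begin

text \<open>
  A noncomputable learner has a locking string on every set it learns: beyond that string, it never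
  changes its mind on data from the set. Hence a family containing \<open>\<omega>\<close> together with
  arbitrarily large initial segments of \<open>\<omega>\<close> is not learnable unless some large segment is
  identified with \<open>\<omega>\<close>. Split the initial segments into countably many infinite columns and,
  for \<open>S \<subseteq> \<omega>\<close>, let \<open>E\<^sub>S\<close> identify \<open>\<omega>\<close> with the segments of the columns
  in \<open>S\<close>. The family formed by \<open>\<omega>\<close> and the \<open>n\<close>-th column is then \<open>E\<^sub>S\<close>-learnable,
  by a constant learner, exactly when \<open>n \<in> S\<close>, while \<open>S \<subseteq> T\<close> makes \<open>E\<^sub>T\<close> coarser than
  \<open>E\<^sub>S\<close>. So \<open>S \<mapsto> E\<^sub>S\<close> embeds the powerset, and chains and antichains of size
  continuum are transported from there.
\<close>

section \<open>Locking strings\<close>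

lemma length_initial_string [simp]: "length (initial_string \<mu> s) = s"
  by (simp add: initial_string_def)

lemma initial_string_extends_prefix:
  assumes "initial_string \<mu> l = \<sigma>" "l \<le> s"
  shows "\<exists>\<tau>. initial_string \<mu> s = \<sigma> @ \<tau> \<and> set \<tau> \<subseteq> range \<mu>"
proof (intro exI conjI)
  show "initial_string \<mu> s = \<sigma> @ map \<mu> [l..<s]"
    using assms upt_add_eq_append[of 0 l "s - l"] by (auto simp: initial_string_def)
qed auto

lemma enumeration_with_prefix:
  assumes "A \<noteq> {}" "set \<sigma> \<subseteq> A"
  obtains \<mu> where "enumeration_of \<mu> A" "initial_string \<mu> (length \<sigma>) = \<sigma>"
proof -
  obtain f :: "nat \<Rightarrow> nat" where f: "range f = A"
    using range_from_nat_into[OF assms(1)] by blast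
  define \<mu> where "\<mu> i = (if i < length \<sigma> then \<sigma> ! i else f (i - length \<sigma>))" for i
  have "f j \<in> range \<mu>" for j
    by (rule range_eqI[of _ _ "j + length \<sigma>"]) (simp add: \<mu>_def)
  moreover have "\<mu> i \<in> A" for i
    using assms(2) f by (auto simp: \<mu>_def)
  ultimately have "range \<mu> = A"
    using f by blast
  moreover have "initial_string \<mu> (length \<sigma>) = \<sigma>"
    by (rule nth_equalityI) (auto simp: initial_string_def \<mu>_def)
  ultimately show ?thesis
    using that by (simp add: enumeration_of_def)
qed

text \<open>Otherwise every string over \<open>A\<close> has an extension inside \<open>A\<close>
  that changes the output of \<open>M\<close>; stringing such extensions together while feeding in
  all of \<open>A\<close> yields an enumeration on which \<open>M\<close> never settles.\<close>

lemma locking_string_exists: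
  fixes M :: "nat list \<Rightarrow> nat"
  assumes "A \<noteq> {}"
    and conv: "\<And>\<mu>. enumeration_of \<mu> A \<Longrightarrow> \<exists>i s\<^sub>0. \<forall>s\<ge>s\<^sub>0. M (initial_string \<mu> s) = i"
  obtains \<sigma> where "set \<sigma> \<subseteq> A" "\<And>\<tau>. set \<tau> \<subseteq> A \<Longrightarrow> M (\<sigma> @ \<tau>) = M \<sigma>"
proof (rule ccontr)
  assume "\<not> thesis"
  then have "\<forall>\<sigma>. \<exists>\<tau>. set \<sigma> \<subseteq> A \<longrightarrow> set \<tau> \<subseteq> A \<and> M (\<sigma> @ \<tau>) \<noteq> M \<sigma>"
    using that by metis
  then obtain t where t: "\<And>\<sigma>. set \<sigma> \<subseteq> A \<Longrightarrow> set (t \<sigma>) \<subseteq> A \<and> M (\<sigma> @ t \<sigma>) \<noteq> M \<sigma>"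
    by metis
  obtain f :: "nat \<Rightarrow> nat" where f: "range f = A"
    using range_from_nat_into[OF assms(1)] by blast
  \<comment> \<open>The appended \<open>f n\<close> makes the limit exhaust \<open>A\<close> and
    gives stage \<open>n\<close> length at least \<open>n\<close>.\<close>
  define \<sigma> where "\<sigma> = rec_nat [] (\<lambda>n \<rho>. \<rho> @ t \<rho> @ [f n])"
  have \<sigma>_Suc: "\<sigma> (Suc n) = \<sigma> n @ t (\<sigma> n) @ [f n]" for n
    by (simp add: \<sigma>_def)
  have \<sigma>_A: "set (\<sigma> n) \<subseteq> A" for n
  proof (induction n)
    case (Suc n)
    then show ?case using t f by (auto simp: \<sigma>_Suc)
  qed (simp add: \<sigma>_def)
  have len: "n \<le> length (\<sigma> n)" for n
    by (induction n) (simp_all add: \<sigma>_Suc)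
  have prefix: "\<exists>\<rho>. \<sigma> n = \<sigma> m @ \<rho>" if "m \<le> n" for m n
    using that by (induction n rule: dec_induct) (auto simp: \<sigma>_Suc)
  define \<mu> where "\<mu> i = \<sigma> (Suc i) ! i" for i
  have \<mu>: "\<mu> i = \<sigma> n ! i" if "i < length (\<sigma> n)" for i n
  proof (cases "Suc i \<le> n")
    case True
    with prefix[OF this] len[of "Suc i"] show ?thesis by (auto simp: \<mu>_def nth_append)
  next
    case False
    with prefix[of n "Suc i"] that show ?thesis by (auto simp: \<mu>_def nth_append)
  qed
  have init: "initial_string \<mu> (length \<rho>) = \<rho>" if "\<sigma> n = \<rho> @ \<rho>'" for n \<rho> \<rho>'
    using that by (intro nth_equalityI) (auto simp: initial_string_def \<mu>[of _ n] nth_append)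
  have "f n \<in> range \<mu>" for n
    using \<mu>[of "length (\<sigma> n @ t (\<sigma> n))" "Suc n"]
    by (metis \<sigma>_Suc append_assoc length_append_singleton lessI nth_append_length rangeI)
  moreover have "\<mu> i \<in> A" for i
    using \<sigma>_A[of "Suc i"] len[of "Suc i"] by (auto simp: \<mu>_def dest: nth_mem)
  ultimately have "enumeration_of \<mu> A"
    using f by (auto simp: enumeration_of_def)
  then obtain i s where s: "\<And>s'. s \<le> s' \<Longrightarrow> M (initial_string \<mu> s') = i"
    using conv by blast
  \<comment> \<open>Two initial strings of \<open>\<mu>\<close> of length at least \<open>s\<close>,
    between which \<open>t\<close> forces a change of output.\<close>
  have "M (\<sigma> s) = i"
    using s[OF len[of s]] init[of s "\<sigma> s" "[]"] by simp
  moreover have "M (\<sigma> s @ t (\<sigma> s)) = i"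
    using s[of "length (\<sigma> s @ t (\<sigma> s))"] init[of "Suc s" "\<sigma> s @ t (\<sigma> s)" "[f s]"] len[of s]
    by (simp add: \<sigma>_Suc)
  ultimately show False
    using t[OF \<sigma>_A[of s]] by simp
qed

text \<open>Angluin's tell-tale condition, up to \<open>E\<close>. The witness is the content of a
  locking string for \<open>W \<phi> a\<close>: an enumeration of \<open>W \<phi> b\<close> can
  start with that string and never leaves \<open>W \<phi> a\<close>, so the locked output is a
  correct guess for both \<open>b\<close> and \<open>a\<close>.\<close>

lemma learnable_tell_tale:
  assumes "equiv UNIV E" "learnable \<phi> E K" "W \<phi> a \<in> K" "W \<phi> a \<noteq> {}"
  shows "\<exists>F. finite F \<and> F \<subseteq> W \<phi> a \<and>
    (\<forall>b. W \<phi> b \<in> K \<longrightarrow> W \<phi> b \<noteq> {} \<longrightarrow> F \<subseteq> W \<phi> b \<longrightarrow> W \<phi> b \<subseteq> W \<phi> a \<longrightarrow> (b, a) \<in> E)"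
proof -
  obtain M where M: "\<And>e \<mu>. W \<phi> e \<in> K \<Longrightarrow> enumeration_of \<mu> (W \<phi> e) \<Longrightarrow>
      \<exists>i. (i, e) \<in> E \<and> (\<exists>s\<^sub>0. \<forall>s\<ge>s\<^sub>0. M (initial_string \<mu> s) = i)"
    using assms(2) unfolding learnable_def by blast
  have "\<And>\<mu>. enumeration_of \<mu> (W \<phi> a) \<Longrightarrow> \<exists>i s\<^sub>0. \<forall>s\<ge>s\<^sub>0. M (initial_string \<mu> s) = i"
    using M[OF assms(3)] by blast
  then obtain \<sigma> where \<sigma>: "set \<sigma> \<subseteq> W \<phi> a"
      "\<And>\<tau>. set \<tau> \<subseteq> W \<phi> a \<Longrightarrow> M (\<sigma> @ \<tau>) = M \<sigma>"
    by (rule locking_string_exists[OF assms(4)]) blast+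
  have lock: "(M \<sigma>, b) \<in> E"
    if b: "W \<phi> b \<in> K" "W \<phi> b \<noteq> {}" "set \<sigma> \<subseteq> W \<phi> b" "W \<phi> b \<subseteq> W \<phi> a" for b
  proof -
    obtain \<mu> where \<mu>: "enumeration_of \<mu> (W \<phi> b)" "initial_string \<mu> (length \<sigma>) = \<sigma>"
      using enumeration_with_prefix b(2,3) by blast
    obtain i s where i: "(i, b) \<in> E" "\<And>s'. s \<le> s' \<Longrightarrow> M (initial_string \<mu> s') = i"
      using M[OF b(1) \<mu>(1)] by blast
    \<comment> \<open>The maximum is late enough for convergence and long enough to contain the
      locking string.\<close>
    obtain \<tau> where "initial_string \<mu> (max s (length \<sigma>)) = \<sigma> @ \<tau>" "set \<tau> \<subseteq> range \<mu>"
      using initial_string_extends_prefix[OF \<mu>(2), of "max s (length \<sigma>)"] by auto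
    with i(2)[of "max s (length \<sigma>)"] \<sigma>(2)[of \<tau>] \<mu>(1) b(4) have "M \<sigma> = i"
      by (auto simp: enumeration_of_def)
    with i(1) show ?thesis by simp
  qed
  have "(b, a) \<in> E" if "W \<phi> b \<in> K" "W \<phi> b \<noteq> {}" "set \<sigma> \<subseteq> W \<phi> b" "W \<phi> b \<subseteq> W \<phi> a" for b
    using lock[OF that] lock[OF assms(3,4) \<sigma>(1)] assms(1)
    by (meson equivE order_refl symD transD)
  with \<sigma>(1) show ?thesis
    by (intro exI[of _ "set \<sigma>"]) blast
qed

section \<open>Some computably enumerable sets\<close>

lemma acceptable_ce_set:
  assumes "acceptable \<phi>" "\<And>x y. eval c [x] y \<longleftrightarrow> x \<in> A \<and> y = 0"
  shows "A \<in> range (W \<phi>)"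
proof -
  define \<psi> where "\<psi> x = (if x \<in> A then Some (0 :: nat) else None)" for x
  have "partial_computable \<psi>"
    unfolding partial_computable_def using assms(2) by (intro exI[of _ c]) (auto simp: \<psi>_def)
  then obtain e where "\<psi> = \<phi> e"
    using assms(1) unfolding acceptable_def by blast
  moreover have "dom \<psi> = A"
    by (auto simp: \<psi>_def split: if_splits)
  ultimately have "W \<phi> e = A"
    by (simp add: W_def)
  then show ?thesis by blast
qed

lemma acceptable_ce_UNIV: "acceptable \<phi> \<Longrightarrow> UNIV \<in> range (W \<phi>)"
  by (erule acceptable_ce_set[of _ Zero]) (auto intro: eval.intros elim: eval.cases)

text \<open>
  A primitive recursion diverges beyond the first argument at which its step function diverges.
\<close>

fun segment_code :: "nat \<Rightarrow> recf" where
  "segment_code 0 = PrimRec Zero (Proj 2)"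
| "segment_code (Suc m) = PrimRec Zero (Comp (segment_code m) [Proj 0])"

inductive_cases eval_ZeroE: "eval Zero xs y"
inductive_cases eval_ProjE: "eval (Proj i) xs y"
inductive_cases eval_CompE: "eval (Comp f gs) xs y"
inductive_cases eval_PrimRec_0E: "eval (PrimRec f g) (0 # xs) y"
inductive_cases eval_PrimRec_SucE: "eval (PrimRec f g) (Suc n # xs) y"

text \<open>Recursion up to \<open>x\<close> must evaluate \<open>g\<close> at every
  \<open>n < x\<close>, so a single gap in \<open>B\<close> blocks all larger arguments.\<close>

lemma eval_PrimRec_Zero_iff:
  assumes "\<And>n y z. eval g [n, y] z \<longleftrightarrow> n \<in> B \<and> z = 0"
  shows "eval (PrimRec Zero g) [x] y \<longleftrightarrow> {..<x} \<subseteq> B \<and> y = 0"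
proof (induction x arbitrary: y)
  case 0
  show ?case
    by (auto intro: eval.intros elim!: eval_PrimRec_0E eval_ZeroE)
next
  case (Suc x)
  have "eval (PrimRec Zero g) [Suc x] y \<longleftrightarrow>
      (\<exists>z. eval (PrimRec Zero g) [x] z \<and> eval g [x, z] y)"
    by (auto intro: eval.intros elim!: eval_PrimRec_SucE)
  then show ?case
    using Suc assms by (auto simp: lessThan_Suc)
qed

lemma eval_segment_code: "eval (segment_code m) [x] y \<longleftrightarrow> x \<le> m \<and> y = 0"
proof (induction m arbitrary: x y)
  case 0
  \<comment> \<open>\<open>Proj 2\<close> is out of range on two arguments, so the recursion is
    defined at 0 only.\<close>
  have "eval (Proj 2) [n, y] z \<longleftrightarrow> n \<in> {} \<and> z = 0" for n y z
    by (auto elim: eval_ProjE)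
  from eval_PrimRec_Zero_iff[OF this] show ?case by auto
next
  case (Suc m)
  have "eval (Comp (segment_code m) [Proj 0]) [n, y] z \<longleftrightarrow> eval (segment_code m) [n] z" for n y z
  proof
    assume "eval (Comp (segment_code m) [Proj 0]) [n, y] z"
    then show "eval (segment_code m) [n] z"
      by (auto simp: list_all2_Cons1 elim!: eval_CompE eval_ProjE)
  next
    assume "eval (segment_code m) [n] z"
    then show "eval (Comp (segment_code m) [Proj 0]) [n, y] z"
      using eval_Proj[of 0 "[n, y]"] by (intro eval_Comp[of _ _ "[n]"]) auto
  qed
  then have "eval (Comp (segment_code m) [Proj 0]) [n, y] z \<longleftrightarrow> n \<in> {..m} \<and> z = 0" for n y z
    using Suc by simp
  moreover have "{..<x} \<subseteq> {..m} \<longleftrightarrow> x \<le> Suc m"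
    by (cases x) (simp_all add: lessThan_Suc_atMost)
  ultimately show ?case
    using eval_PrimRec_Zero_iff[of "Comp (segment_code m) [Proj 0]" "{..m}"] by simp
qed

lemma acceptable_ce_atMost: "acceptable \<phi> \<Longrightarrow> {..m} \<in> range (W \<phi>)"
  by (erule acceptable_ce_set[of _ "segment_code m"]) (simp add: eval_segment_code)

section \<open>Embedding the powerset\<close>

text \<open>\<open>UNIV\<close> belongs to every column; injectivity of the pairing keeps the
  columns otherwise disjoint.\<close>

definition column :: "nat \<Rightarrow> nat set set" where
  "column n = insert UNIV (range (\<lambda>k. {..prod_encode (n, k)}))"

text \<open>For empty \<open>S\<close> the union is empty and this is plain \<open>eq_ce\<close>;
  otherwise all merged indices form the single class of the indices of \<open>UNIV\<close>.\<close>

definition collapse_rel :: "(nat \<Rightarrow> nat \<rightharpoonup> nat) \<Rightarrow> nat set \<Rightarrow> nat rel" where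
  "collapse_rel \<phi> S =
     {(e, e'). W \<phi> e = W \<phi> e' \<or> W \<phi> e \<in> \<Union> (column ` S) \<and> W \<phi> e' \<in> \<Union> (column ` S)}"

lemma collapse_rel_R_ce: "collapse_rel \<phi> S \<in> R_ce \<phi>"
  unfolding R_ce_def eq_ce_def collapse_rel_def
  by (auto intro!: equivI simp: refl_on_def sym_def trans_def)

lemma ce_family_column: "acceptable \<phi> \<Longrightarrow> ce_family \<phi> (column n)"
  using acceptable_ce_UNIV acceptable_ce_atMost by (force simp: ce_family_def column_def)

lemma column_learnable:
  assumes "acceptable \<phi>" "n \<in> S"
  shows "learnable \<phi> (collapse_rel \<phi> S) (column n)"
proof -
  obtain u where "W \<phi> u = UNIV"
    using acceptable_ce_UNIV[OF assms(1)] by auto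
  then have "(u, e) \<in> collapse_rel \<phi> S" if "W \<phi> e \<in> column n" for e
    using that assms(2) by (auto simp: collapse_rel_def column_def)
  then show ?thesis
    unfolding learnable_def by (intro exI[of _ "\<lambda>_. u"]) blast
qed

text \<open>A finite tell-tale for \<open>UNIV\<close> would lie inside some segment of column
  \<open>n\<close>, which would then be related to \<open>UNIV\<close> although \<open>n\<close> is
  not in \<open>S\<close>.\<close>

lemma column_not_learnable:
  assumes "acceptable \<phi>" "n \<notin> S"
  shows "\<not> learnable \<phi> (collapse_rel \<phi> S) (column n)"
proof
  assume L: "learnable \<phi> (collapse_rel \<phi> S) (column n)"
  obtain u where u: "W \<phi> u = UNIV"
    using acceptable_ce_UNIV[OF assms(1)] by auto
  have eq: "equiv UNIV (collapse_rel \<phi> S)"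
    using collapse_rel_R_ce[of \<phi> S] by (simp add: R_ce_def)
  have "W \<phi> u \<in> column n" "W \<phi> u \<noteq> {}"
    using u by (simp_all add: column_def)
  from learnable_tell_tale[OF eq L this]
  obtain F where "finite F" and tale: "\<And>b. W \<phi> b \<in> column n \<Longrightarrow> W \<phi> b \<noteq> {} \<Longrightarrow>
      F \<subseteq> W \<phi> b \<Longrightarrow> W \<phi> b \<subseteq> W \<phi> u \<Longrightarrow> (b, u) \<in> collapse_rel \<phi> S"
    by blast
  from \<open>finite F\<close> obtain k where k: "F \<subseteq> {..k}"
    by (auto simp: finite_nat_set_iff_bounded_le)
  obtain b where b: "W \<phi> b = {..prod_encode (n, k)}"
    using acceptable_ce_atMost[OF assms(1)] by fastforce
  \<comment> \<open>Segments never equal \<open>UNIV\<close>, so the relation can hold only through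
    the merged class, and a segment determines its column.\<close>
  have ne: "{..j} \<noteq> UNIV" for j :: nat
    using infinite_UNIV_nat finite_atMost[of j] by metis
  have "F \<subseteq> W \<phi> b"
    using k b le_prod_encode_2[of k n] by fastforce
  then have "(b, u) \<in> collapse_rel \<phi> S"
    using b u by (intro tale) (auto simp: column_def)
  then have "{..prod_encode (n, k)} \<in> \<Union> (column ` S)"
    using b u ne by (simp add: collapse_rel_def)
  then obtain n' where "n' \<in> S" "{..prod_encode (n, k)} \<in> column n'"
    by blast
  then have "n \<in> S"
    using ne by (auto simp: column_def prod_encode_eq)
  with assms(2) show False by blast
qed

text \<open>For \<open>n\<close> in \<open>S\<close> but not in \<open>T\<close>, the family
  \<open>column n\<close> separates the two relations; conversely, a coarser relation accepts the
  same learner.\<close>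

lemma learn_le_collapse_rel_iff:
  assumes "acceptable \<phi>"
  shows "learn_le \<phi> (collapse_rel \<phi> S) (collapse_rel \<phi> T) \<longleftrightarrow> S \<subseteq> T"
proof
  assume "learn_le \<phi> (collapse_rel \<phi> S) (collapse_rel \<phi> T)"
  then show "S \<subseteq> T"
    using ce_family_column column_learnable column_not_learnable assms
    unfolding learn_le_def by blast
next
  assume "S \<subseteq> T"
  then have "collapse_rel \<phi> S \<subseteq> collapse_rel \<phi> T"
    by (auto simp: collapse_rel_def)
  then show "learn_le \<phi> (collapse_rel \<phi> S) (collapse_rel \<phi> T)"
    unfolding learn_le_def learnable_def by blast
qed

lemma Field_subset_rel [simp]: "Field {(A, B). A \<subseteq> B} = UNIV"
  by (auto simp: Field_def)

lemma order_embedding_powerset_TLH: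
  assumes "acceptable \<phi>"
  shows "order_embedding {(A, B :: nat set). A \<subseteq> B} (TLH \<phi>)
    (\<lambda>S. learn_equiv \<phi> `` {collapse_rel \<phi> S})" (is "order_embedding _ _ ?h")
proof -
  have iff: "(?h S, ?h T) \<in> TLH \<phi> \<longleftrightarrow> S \<subseteq> T" for S T
    by (simp add: TLH_class_iff collapse_rel_R_ce learn_le_collapse_rel_iff assms)
  have "inj ?h"
  proof (rule injI)
    fix S T assume "?h S = ?h T"
    then show "S = T"
      using iff[of S T] iff[of T S] iff[of S S] by auto
  qed
  moreover have "?h S \<in> Field (TLH \<phi>)" for S
    using iff[of S S] by (blast intro: FieldI1)
  ultimately show ?thesis
    using iff by (auto simp: order_embedding_def)
qed

section \<open>Cardinalities\<close>

text \<open>The type \<open>'a\<close> is left open to serve both sets of naturals and relations,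
  that is, sets of pairs.\<close>

lemma card_of_UNIV_set_ordIso_continuum:
  fixes f :: "nat \<Rightarrow> 'a"
  assumes "bij f"
  shows "|UNIV :: 'a set set| =o ctwo ^c natLeq"
proof -
  have "bij_betw (image f) (UNIV :: nat set set) UNIV"
    using bij_betw_Pow[OF assms] by simp
  then have "|UNIV :: 'a set set| =o |UNIV :: nat set set|"
    using card_of_ordIso ordIso_symmetric by blast
  also have "|UNIV :: nat set set| =o |Func (UNIV :: nat set) (UNIV :: bool set)|"
    using card_of_Pow_Func[of "UNIV :: nat set"] by simp
  finally show ?thesis
    by (simp add: cexp_def ctwo_def Field_natLeq Field_card_of)
qed

lemma card_of_E_ce_le: "|E_ce \<phi>| \<le>o ctwo ^c natLeq"
proof -
  have "|E_ce \<phi>| \<le>o |R_ce \<phi>|"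
    unfolding E_ce_def quotient_def by (rule surj_imp_ordLeq) auto
  also have "|R_ce \<phi>| \<le>o |UNIV :: nat rel set|"
    by (simp add: card_of_mono1)
  also have "|UNIV :: nat rel set| =o ctwo ^c natLeq"
    using card_of_UNIV_set_ordIso_continuum bij_prod_decode by blast
  finally show ?thesis .
qed

section \<open>Antichains and chains of size continuum in the powerset of the naturals\<close>

lemma powerset_antichain:
  "\<exists>g :: nat set \<Rightarrow> nat set. inj g \<and> (\<forall>X Y. g X \<subseteq> g Y \<longrightarrow> X = Y)"
proof -
  \<comment> \<open>The even part of \<open>g X \<subseteq> g Y\<close> gives
    \<open>X \<subseteq> Y\<close>; the odd part, coding complements, gives the reverse.\<close>
  define g where "g X = (\<lambda>n. 2 * n) ` X \<union> (\<lambda>n. 2 * n + 1) ` (- X)" for X :: "nat set"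
  have "X = Y" if "g X \<subseteq> g Y" for X Y
  proof (intro set_eqI)
    fix n
    have "2 * n \<in> g Z \<longleftrightarrow> n \<in> Z" "2 * n + 1 \<in> g Z \<longleftrightarrow> n \<notin> Z" for Z
      by (auto simp: g_def) presburger+
    with that show "n \<in> X \<longleftrightarrow> n \<in> Y" by blast
  qed
  then show ?thesis by (metis injI order_refl)
qed

text \<open>
  \<open>lex_cut X\<close> consists of the codes of the finite sets whose characteristic sequence is
  lexicographically at most that of \<open>X\<close>: the analogue of a Dedekind cut.
\<close>

definition lex_cut :: "nat set \<Rightarrow> nat set" where
  "lex_cut X = {i. \<not> (\<exists>m\<in>set_decode i. m \<notin> X \<and> (\<forall>j<m. j \<in> set_decode i \<longleftrightarrow> j \<in> X))}"

text \<open>\<open>m\<close> is the first difference, so \<open>X\<close> precedes \<open>Y\<close>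
  lexicographically.\<close>

lemma lex_cut_psubset:
  assumes m: "m \<in> Y" "m \<notin> X" and agree: "\<And>j. j < m \<Longrightarrow> j \<in> X \<longleftrightarrow> j \<in> Y"
  shows "lex_cut X \<subset> lex_cut Y"
proof
  show "lex_cut X \<subseteq> lex_cut Y"
  proof
    fix i assume "i \<in> lex_cut X"
    then have i: "\<And>l. l \<in> set_decode i \<Longrightarrow> l \<notin> X \<Longrightarrow> \<exists>j<l. (j \<in> set_decode i) \<noteq> (j \<in> X)"
      by (auto simp: lex_cut_def)
    show "i \<in> lex_cut Y"
    proof (rule ccontr)
      assume "i \<notin> lex_cut Y"
      then obtain l where l: "l \<in> set_decode i" "l \<notin> Y" "\<And>j. j < l \<Longrightarrow> j \<in> set_decode i \<longleftrightarrow> j \<in> Y"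
        by (auto simp: lex_cut_def)
      show False
      \<comment> \<open>If \<open>l < m\<close>, then \<open>l\<close> also keeps \<open>i\<close>
        out of \<open>lex_cut X\<close>; if \<open>l > m\<close>, the set coded by \<open>i\<close>
        contains \<open>m\<close> as \<open>Y\<close> does, and \<open>m\<close> keeps
        \<open>i\<close> out.\<close>
      proof (cases l m rule: linorder_cases)
        case less
        with agree[of l] l i[of l] agree show False by (metis less_trans)
      next
        case equal
        with l m show False by simp
      next
        case greater
        with l m i[of m] agree show False by (metis less_trans)
      qed
    qed
  qed
  \<comment> \<open>\<open>Y\<close> cut off after \<open>m\<close> is at most \<open>Y\<close> but
    already exceeds \<open>X\<close> at \<open>m\<close>.\<close>
  define i where "i = set_encode (Y \<inter> {..m})"
  have "set_decode i = Y \<inter> {..m}"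
    by (simp add: i_def)
  then have "i \<in> lex_cut Y" "i \<notin> lex_cut X"
    using m agree by (auto simp: lex_cut_def intro!: bexI[of _ m])
  then show "lex_cut X \<noteq> lex_cut Y" by blast
qed

text \<open>The least difference of two distinct sets makes their cuts strictly comparable, which
  gives totality and injectivity at once.\<close>

lemma powerset_chain:
  "\<exists>g :: nat set \<Rightarrow> nat set. inj g \<and> (\<forall>X Y. g X \<subseteq> g Y \<or> g Y \<subseteq> g X)"
proof -
  have lin: "lex_cut X \<subset> lex_cut Y \<or> lex_cut Y \<subset> lex_cut X" if "X \<noteq> Y" for X Y
  proof -
    define m where "m = (LEAST m. (m \<in> X) \<noteq> (m \<in> Y))"
    have "\<exists>m. (m \<in> X) \<noteq> (m \<in> Y)"
      using that by blast
    then have "(m \<in> X) \<noteq> (m \<in> Y)"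
      unfolding m_def by (rule LeastI_ex)
    moreover have "j \<in> X \<longleftrightarrow> j \<in> Y" if "j < m" for j
      using not_less_Least[OF that[unfolded m_def]] by blast
    ultimately show ?thesis
      using lex_cut_psubset[of m Y X] lex_cut_psubset[of m X Y] by blast
  qed
  have "inj lex_cut"
    using lin by (metis injI psubset_eq)
  with lin show ?thesis
    by (metis order_refl psubset_imp_subset)
qed

text \<open>A member of size \<open>\<kappa>\<close> forces every competing bound up to
  \<open>\<kappa>\<close>.\<close>

lemma is_card_SupI_attained:
  assumes "Card_order \<kappa>" "\<And>C. C \<in> \<C> \<Longrightarrow> |C| \<le>o \<kappa>" "C \<in> \<C>" "|C| =o \<kappa>"
  shows "is_card_Sup \<C> \<kappa>"
  unfolding is_card_Sup_def using assms by (metis ordIso_ordLeq_trans ordIso_symmetric)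

theorem corollary4p4:
  fixes \<phi> :: "nat \<Rightarrow> nat \<rightharpoonup> nat"
  assumes "acceptable \<phi>"
  shows "(\<exists>h. order_embedding {(A, B :: nat set). A \<subseteq> B} (TLH \<phi>) h) \<and>
    (\<exists>C\<in>Antichains (TLH \<phi>). |C| =o ctwo ^c natLeq) \<and>
    (\<exists>C\<in>Chains (TLH \<phi>). |C| =o ctwo ^c natLeq) \<and>
    has_width (TLH \<phi>) (ctwo ^c natLeq) \<and>
    has_height (TLH \<phi>) (ctwo ^c natLeq)"
proof -
  obtain h where h: "order_embedding {(A, B :: nat set). A \<subseteq> B} (TLH \<phi>) h"
    using order_embedding_powerset_TLH[OF assms] by blast
  then have "inj h" and h_Field: "\<And>A. h A \<in> Field (TLH \<phi>)"
    and h_iff: "\<And>A B. (h A, h B) \<in> TLH \<phi> \<longleftrightarrow> A \<subseteq> B"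
    by (auto simp: order_embedding_def)
  \<comment> \<open>Antichains and chains of the powerset come as ranges of injections
    \<open>g\<close>, and \<open>h\<close> carries them over at full size.\<close>
  have continuum: "|range (\<lambda>X. h (g X))| =o ctwo ^c natLeq" if "inj g" for g :: "nat set \<Rightarrow> nat set"
  proof -
    have "bij_betw (\<lambda>X. h (g X)) UNIV (range (\<lambda>X. h (g X)))"
      using inj_compose[OF \<open>inj h\<close> that] by (simp add: bij_betw_def comp_def)
    then have "|range (\<lambda>X. h (g X))| =o |UNIV :: nat set set|"
      using card_of_ordIso ordIso_symmetric by blast
    then show ?thesis
      using card_of_UNIV_set_ordIso_continuum[of id] ordIso_transitive by auto
  qed
  obtain a where a: "inj a" "\<And>X Y :: nat set. a X \<subseteq> (a Y :: nat set) \<Longrightarrow> X = Y"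
    using powerset_antichain by blast
  obtain c where c: "inj c" "\<And>X Y :: nat set. c X \<subseteq> (c Y :: nat set) \<or> c Y \<subseteq> c X"
    using powerset_chain by blast
  have a_eq: "X = Y" if "(h (a X), h (a Y)) \<in> TLH \<phi>" for X Y
    using that by (intro a(2)) (simp add: h_iff)
  have A: "range (\<lambda>X. h (a X)) \<in> Antichains (TLH \<phi>)"
    unfolding Antichains_def using h_Field a_eq by blast
  have c_total: "(h (c X), h (c Y)) \<in> TLH \<phi> \<or> (h (c Y), h (c X)) \<in> TLH \<phi>" for X Y
    using c(2) by (simp add: h_iff)
  have C: "range (\<lambda>X. h (c X)) \<in> Chains (TLH \<phi>)"
    unfolding Chains_def using c_total by blast
  have bound: "|D| \<le>o ctwo ^c natLeq" if "D \<subseteq> Field (TLH \<phi>)" for D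
    using ordLeq_transitive[OF card_of_mono1[OF that[unfolded Field_TLH]] card_of_E_ce_le] .
  have "has_width (TLH \<phi>) (ctwo ^c natLeq)"
    unfolding has_width_def
    by (rule is_card_SupI_attained[OF Card_order_cexp bound A continuum[OF a(1)]])
      (auto simp: Antichains_def)
  moreover have "has_height (TLH \<phi>) (ctwo ^c natLeq)"
    unfolding has_height_def
    by (rule is_card_SupI_attained[OF Card_order_cexp bound C continuum[OF c(1)]])
      (auto simp: Chains_def Field_def)
  ultimately show ?thesis
    using h A C continuum[OF a(1)] continuum[OF c(1)] by blast
qed

end
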